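(* Let $\phi_j(x)$ be the $j$-th eigenfunction of the Neumann Laplacian on $[-1,1]$ and let $T_j$ denote the $j$-th Chebyshev polynomial of the first kind. Then $\phi_1(x)$ is the first non-constant eigenfunction and $$\phi_j(x)=\begin{cases}(-1)^{\frac{j+2}{2}}\,T_j(\phi_1(x)) & \text{if } j \text{ is even, and}\\ (-1)^{\frac{j+1}{2}}\,T_j(\phi_1(x)) & \text{if } j \text{ is odd}.\end{cases}$$
   Context: The Neumann Laplacian on $[-1,1]$ is the operator $\frac{d^2}{dx^2}$ with domain the absolutely continuous functions $f$ on $[-1,1]$ satisfying $f'(-1)=f'(1)=0$. Its $j$-th eigenfunction, satisfying $\phi_j''=-\bigl(\tfrac12 j\pi\bigr)^2\phi_j$, is $\phi_j(x)=\cos\bigl(\tfrac12 j\pi x\bigr)$ if $j$ is even and $\phi_j(x)=\sin\bigl(\tfrac12 j\pi x\bigr)$ if $j$ is odd; $j=0$ gives the constant eigenfunction. The Chebyshev polynomials of the first kind satisfy $T_j(\cos\theta)=\cos(j\theta)$.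
   Formalization: The printed signs are wrong for every j (j=0 gives 1=-1, j=1 gives φ_1=-φ_1); the exponents are corrected to j/2 for even j and (j-1)/2 for odd j. The Laplacian's domain also asks that f' be absolutely continuous, so that f'' makes sense almost everywhere. *)

theory Defs
  imports "HOL-Analysis.Analysis" "HOL-Computational_Algebra.Polynomial"
begin

fun chebyshev_T :: "nat \<Rightarrow> real poly" where
  "chebyshev_T 0 = 1"
| "chebyshev_T (Suc 0) = [:0, 1:]"
| "chebyshev_T (Suc (Suc n)) = [:0, 2:] * chebyshev_T (Suc n) - chebyshev_T n"

lemma poly_chebyshev_T_cos: "poly (chebyshev_T n) (cos t) = cos (real n * t)"
proof (induction n rule: chebyshev_T.induct)
  case (3 n)
  have "cos (real (Suc (Suc n)) * t) + cos (real n * t) = 2 * cos t * cos (real (Suc n) * t)"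
    using cos_add[of "real (Suc n) * t" t] cos_diff[of "real (Suc n) * t" t]
    by (simp add: algebra_simps)
  with 3 show ?case by (simp add: algebra_simps)
qed auto

(* Absolute continuity of a function on a compact interval, in the epsilon-delta sense: the open
   intervals ]l i, r i[, i < n, form an arbitrary finite disjoint family. *)
definition abs_continuous_on :: "real \<Rightarrow> real \<Rightarrow> (real \<Rightarrow> real) \<Rightarrow> bool" where
  "abs_continuous_on a b f \<longleftrightarrow>
     (\<forall>\<epsilon>>0. \<exists>\<delta>>0. \<forall>n. \<forall>l r :: nat \<Rightarrow> real.
        (\<forall>i<n. a \<le> l i \<and> l i \<le> r i \<and> r i \<le> b) \<and>
        disjoint_family_on (\<lambda>i. {l i<..<r i}) {..<n} \<and>
        (\<Sum>i<n. r i - l i) < \<delta>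
        \<longrightarrow> (\<Sum>i<n. \<bar>f (r i) - f (l i)\<bar>) < \<epsilon>)"

(* The graph of the Neumann Laplacian d^2/dx^2 on [-1,1]: f lies in the domain and g is the second
   derivative of f.  For the second derivative to make sense, f must have a derivative (one-sided
   at the endpoints) that is again absolutely continuous; it is then differentiable almost
   everywhere only, so g is determined almost everywhere.  Only values on [-1,1] matter. *)
definition neumann_laplacian :: "(real \<Rightarrow> real) \<Rightarrow> (real \<Rightarrow> real) \<Rightarrow> bool" where
  "neumann_laplacian f g \<longleftrightarrow>
     abs_continuous_on (-1) 1 f \<and>
     (\<exists>f'. (\<forall>x\<in>{-1..1}. (f has_real_derivative f' x) (at x within {-1..1})) \<and>
           abs_continuous_on (-1) 1 f' \<and> f' (-1) = 0 \<and> f' 1 = 0 \<and>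
           (AE x in lebesgue_on {-1..1}. (f' has_real_derivative g x) (at x within {-1..1})))"

definition neumann_eigenfunction :: "real \<Rightarrow> (real \<Rightarrow> real) \<Rightarrow> bool" where
  "neumann_eigenfunction \<mu> f \<longleftrightarrow>
     neumann_laplacian f (\<lambda>x. \<mu> * f x) \<and> (\<exists>x\<in>{-1..1}. f x \<noteq> 0)"

definition neumann_eigenvalue :: "real \<Rightarrow> bool" where
  "neumann_eigenvalue \<mu> \<longleftrightarrow> (\<exists>f. neumann_eigenfunction \<mu> f)"

(* Eigenvalues of d^2/dx^2 are nonpositive and are enumerated downwards from 0, so the j-th one
   (starting with j = 0) has exactly j eigenvalues above it. *)
definition is_jth_neumann_eigenfunction :: "nat \<Rightarrow> (real \<Rightarrow> real) \<Rightarrow> bool" where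
  "is_jth_neumann_eigenfunction j f \<longleftrightarrow>
     (\<exists>\<mu>. neumann_eigenfunction \<mu> f \<and>
          finite {\<nu>. neumann_eigenvalue \<nu> \<and> \<nu> > \<mu>} \<and>
          card {\<nu>. neumann_eigenvalue \<nu> \<and> \<nu> > \<mu>} = j)"

definition is_first_nonconstant_neumann_eigenfunction :: "(real \<Rightarrow> real) \<Rightarrow> bool" where
  "is_first_nonconstant_neumann_eigenfunction f \<longleftrightarrow>
     (\<exists>\<mu>. neumann_eigenfunction \<mu> f \<and> \<not> f constant_on {-1..1} \<and>
          (\<forall>\<nu> g. neumann_eigenfunction \<nu> g \<and> \<not> g constant_on {-1..1} \<longrightarrow> \<nu> \<le> \<mu>))"

definition neumann_phi :: "nat \<Rightarrow> real \<Rightarrow> real" where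
  "neumann_phi j x =
     (if even j then cos (real j * pi * x / 2) else sin (real j * pi * x / 2))"

end

theory Submission
  imports Defs
begin

text \<open>
  Both $\phi_j$ and $T_j(\phi_1)$ are cosines of $j$ times an angle. With $\theta = \pi(1-x)/2$ we
  have $\phi_1(x) = \cos\theta$, so $T_j(\phi_1(x)) = \cos(j\theta)$, and expanding
  $\cos(j\pi/2 - j\pi x/2)$ gives $\phi_j(x)$ up to the sign $(-1)^{j/2}$ for even $j$ and
  $(-1)^{(j-1)/2}$ for odd $j$ (\<open>neumann_phi_chebyshev\<close>).

  The remaining work is to show that the $\phi_j$ exhaust the eigenfunctions, in the right order,
  although the eigenvalue equation $f'' = \mu f$ is imposed only almost everywhere, with $f'$
  absolutely continuous. An absolutely continuous function is the integral of its
  almost-everywhere derivative (\<open>abs_continuous_on_has_integral\<close>). Since $\mu f$ is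
  continuous, $f'$ is then continuously differentiable and the equation holds at every point
  (\<open>neumann_eigenfunction_classical\<close>). From here the problem is a classical one. If
  $\mu \ge 0$, integrating $(f f')' = f'^2 + \mu f^2$ over the interval gives zero, so $f$ is
  constant and $\mu = 0$ (\<open>neumann_eigenvalue_nonneg\<close>). If $\mu = -k^2 < 0$, the solution with
  $f'(-1) = 0$ is a multiple of $\cos(k(x+1))$ (\<open>harmonic_oscillator_cos\<close>), and $f'(1) = 0$
  forces $k = j\pi/2$, which makes $f$ a multiple of $\phi_j$
  (\<open>neumann_eigenfunction_classification\<close>). The eigenvalues $-(j\pi/2)^2$ are strictly
  decreasing in $j$, so exactly $j$ of them lie above the one of $\phi_j$.
\<close>

section \<open>The fundamental theorem of calculus for absolutely continuous functions\<close>

text \<open>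
  The derivative is bounded on a compact interval, so the function is Lipschitz there; this puts
  the trigonometric eigenfunctions into the domain of the operator.
\<close>

lemma continuously_differentiable_imp_abs_continuous_on:
  fixes f f' :: "real \<Rightarrow> real"
  assumes deriv: "\<And>x. x \<in> {a..b} \<Longrightarrow> (f has_real_derivative f' x) (at x within {a..b})"
    and cont: "continuous_on {a..b} f'"
  shows "abs_continuous_on a b f"
proof -
  have "bounded (f' ` {a..b})"
    using compact_continuous_image[OF cont] compact_imp_bounded by blast
  then obtain B where "B > 0" and B: "\<And>x. x \<in> {a..b} \<Longrightarrow> \<bar>f' x\<bar> \<le> B"
    unfolding bounded_pos by auto
  have lip: "\<bar>f v - f u\<bar> \<le> B * (v - u)" if "a \<le> u" "u \<le> v" "v \<le> b" for u v
    using field_differentiable_bound[of "{a..b}" f f' B u v] deriv B that by auto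
  show ?thesis
    unfolding abs_continuous_on_def
  proof (intro allI impI)
    fix \<epsilon> :: real assume "\<epsilon> > 0"
    show "\<exists>\<delta>>0. \<forall>n::nat. \<forall>l r. (\<forall>i<n. a \<le> l i \<and> l i \<le> r i \<and> r i \<le> b) \<and>
        disjoint_family_on (\<lambda>i. {l i<..<r i}) {..<n} \<and> (\<Sum>i<n. r i - l i) < \<delta>
        \<longrightarrow> (\<Sum>i<n. \<bar>f (r i) - f (l i)\<bar>) < \<epsilon>"
    proof (intro exI[of _ "\<epsilon> / B"] conjI allI impI)
      fix n :: nat and l r :: "nat \<Rightarrow> real"
      assume "(\<forall>i<n. a \<le> l i \<and> l i \<le> r i \<and> r i \<le> b) \<and>
        disjoint_family_on (\<lambda>i. {l i<..<r i}) {..<n} \<and> (\<Sum>i<n. r i - l i) < \<epsilon> / B"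
      then have I: "\<forall>i<n. a \<le> l i \<and> l i \<le> r i \<and> r i \<le> b"
        and small: "(\<Sum>i<n. r i - l i) < \<epsilon> / B" by auto
      have "(\<Sum>i<n. \<bar>f (r i) - f (l i)\<bar>) \<le> (\<Sum>i<n. B * (r i - l i))"
        using I by (intro sum_mono lip) auto
      also have "\<dots> = B * (\<Sum>i<n. r i - l i)" by (simp add: sum_distrib_left)
      also have "\<dots> < \<epsilon>" using small \<open>B > 0\<close> by (simp add: field_simps)
      finally show "(\<Sum>i<n. \<bar>f (r i) - f (l i)\<bar>) < \<epsilon>" .
    qed (use \<open>\<epsilon> > 0\<close> \<open>B > 0\<close> in auto)
  qed
qed

text \<open>
  Absolute continuity for families over any finite index set. The gauge argument below applies it to
  the tagged intervals of a division, which carry no natural enumeration.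
\<close>

lemma abs_continuous_onE_finite:
  assumes "abs_continuous_on a b f" "\<epsilon> > 0"
  obtains \<delta> where "\<delta> > 0"
    and "\<And>P l r. \<lbrakk>finite (P :: 'i set); \<And>i. i \<in> P \<Longrightarrow> a \<le> l i \<and> l i \<le> r i \<and> r i \<le> b;
            disjoint_family_on (\<lambda>i. {l i<..<r i}) P; (\<Sum>i\<in>P. r i - l i) < \<delta>\<rbrakk>
         \<Longrightarrow> (\<Sum>i\<in>P. \<bar>f (r i) - f (l i)\<bar>) < \<epsilon>"
proof -
  obtain \<delta> where "\<delta> > 0" and ac: "\<forall>n. \<forall>l r :: nat \<Rightarrow> real.
      (\<forall>i<n. a \<le> l i \<and> l i \<le> r i \<and> r i \<le> b) \<and>
      disjoint_family_on (\<lambda>i. {l i<..<r i}) {..<n} \<and> (\<Sum>i<n. r i - l i) < \<delta>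
      \<longrightarrow> (\<Sum>i<n. \<bar>f (r i) - f (l i)\<bar>) < \<epsilon>"
    using assms(1)[unfolded abs_continuous_on_def, rule_format, OF assms(2)] by (elim exE conjE)
  show thesis
  proof (rule that[OF \<open>\<delta> > 0\<close>])
    fix P :: "'i set" and l r :: "'i \<Rightarrow> real"
    assume P: "finite P" "\<And>i. i \<in> P \<Longrightarrow> a \<le> l i \<and> l i \<le> r i \<and> r i \<le> b"
      "disjoint_family_on (\<lambda>i. {l i<..<r i}) P" "(\<Sum>i\<in>P. r i - l i) < \<delta>"
    obtain h where h: "bij_betw h {..<card P} P"
      using ex_bij_betw_nat_finite[OF P(1)] atLeast0LessThan by metis
    have reindex: "(\<Sum>i<card P. g (h i)) = sum g P" for g :: "'i \<Rightarrow> real"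
      using sum.reindex_bij_betw[OF h] .
    have "(\<Sum>i<card P. \<bar>f ((r \<circ> h) i) - f ((l \<circ> h) i)\<bar>) < \<epsilon>"
    proof (rule ac[rule_format], intro conjI)
      show "\<forall>i<card P. a \<le> (l \<circ> h) i \<and> (l \<circ> h) i \<le> (r \<circ> h) i \<and> (r \<circ> h) i \<le> b"
        using P(2) bij_betwE[OF h] by auto
      show "disjoint_family_on (\<lambda>i. {(l \<circ> h) i<..<(r \<circ> h) i}) {..<card P}"
        unfolding disjoint_family_on_def
      proof (intro ballI impI)
        fix i j assume "i \<in> {..<card P}" "j \<in> {..<card P}" "i \<noteq> j"
        then have "h i \<in> P" "h j \<in> P" "h i \<noteq> h j"
          using bij_betwE[OF h] bij_betw_imp_inj_on[OF h] by (auto dest: inj_onD)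
        then show "{(l \<circ> h) i<..<(r \<circ> h) i} \<inter> {(l \<circ> h) j<..<(r \<circ> h) j} = {}"
          using P(3) by (auto simp: disjoint_family_on_def)
      qed
      show "(\<Sum>i<card P. (r \<circ> h) i - (l \<circ> h) i) < \<delta>"
        using P(4) reindex[of "\<lambda>i. r i - l i"] by simp
    qed
    then show "(\<Sum>i\<in>P. \<bar>f (r i) - f (l i)\<bar>) < \<epsilon>"
      using reindex[of "\<lambda>i. \<bar>f (r i) - f (l i)\<bar>"] by simp
  qed
qed

lemma abs_continuous_on_subinterval:
  assumes "abs_continuous_on a b f" "a \<le> c" "d \<le> b"
  shows "abs_continuous_on c d f"
proof -
  have "a \<le> x \<and> x \<le> y \<and> y \<le> b" if "c \<le> x \<and> x \<le> y \<and> y \<le> d" for x y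
    using that assms(2,3) by linarith
  then show ?thesis
    using assms(1) unfolding abs_continuous_on_def by meson
qed

lemma sum_length_le_measure:
  fixes l r :: "'i \<Rightarrow> real"
  assumes "finite P" "\<And>i. i \<in> P \<Longrightarrow> l i \<le> r i" "disjoint_family_on (\<lambda>i. {l i<..<r i}) P"
    and "\<And>i. i \<in> P \<Longrightarrow> {l i<..<r i} \<subseteq> U" "U \<in> lmeasurable"
  shows "(\<Sum>i\<in>P. r i - l i) \<le> measure lebesgue U"
proof -
  have "(\<Sum>i\<in>P. r i - l i) = (\<Sum>i\<in>P. measure lebesgue {l i<..<r i})"
    using assms(2) by (intro sum.cong) auto
  also have "\<dots> = measure lebesgue (\<Union>i\<in>P. {l i<..<r i})"
    using assms(1-3) by (intro measure_finite_Union[symmetric]) auto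
  also have "\<dots> \<le> measure lebesgue U"
    using assms(1,4,5) by (intro measure_mono_fmeasurable sets.finite_UN) auto
  finally show ?thesis .
qed

text \<open>
  Differentiability at a tag controls the increment over every short interval containing the tag,
  because the two halves of the interval on either side of it add up.
\<close>

lemma straddle:
  fixes f :: "real \<Rightarrow> real"
  assumes "(f has_real_derivative D) (at x within S)" "\<epsilon> > 0"
  obtains d where "d > 0"
    and "\<And>u v. \<lbrakk>u \<in> S; v \<in> S; u \<le> x; x \<le> v; u \<in> ball x d; v \<in> ball x d\<rbrakk>
          \<Longrightarrow> \<bar>(f v - f u) - D * (v - u)\<bar> \<le> \<epsilon> * (v - u)"
proof -
  obtain d where "d > 0" and d: "\<And>y. y \<in> S \<Longrightarrow> \<bar>y - x\<bar> < d
      \<Longrightarrow> \<bar>f y - f x - D * (y - x)\<bar> \<le> \<epsilon> * \<bar>y - x\<bar>"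
    using assms unfolding has_field_derivative_def has_derivative_within_alt by fastforce
  show thesis
  proof (rule that[OF \<open>d > 0\<close>])
    fix u v assume *: "u \<in> S" "v \<in> S" "u \<le> x" "x \<le> v" "u \<in> ball x d" "v \<in> ball x d"
    have "\<bar>f v - f x - D * (v - x)\<bar> \<le> \<epsilon> * (v - x)" "\<bar>f u - f x - D * (u - x)\<bar> \<le> \<epsilon> * (x - u)"
      using d[of v] d[of u] * by (auto simp: dist_real_def)
    then show "\<bar>(f v - f u) - D * (v - u)\<bar> \<le> \<epsilon> * (v - u)"
      by (simp add: algebra_simps abs_le_iff)
  qed
qed

text \<open>
  The fundamental theorem of calculus for absolutely continuous functions, in the sense of the
  gauge integral. Choose an open set \<open>U\<close> of small measure around the exceptional set
  \<open>N\<close>, and a gauge that confines the intervals tagged in \<open>N\<close> to \<open>U\<close>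
  and makes the straddle estimate available at all other tags. In a fine division, the intervals of
  the first kind have small total length, so absolute continuity bounds their total increment;
  those of the second kind contribute an error proportional to their length.
\<close>

theorem abs_continuous_on_has_integral:
  fixes F h :: "real \<Rightarrow> real"
  assumes "a \<le> b" and ac: "abs_continuous_on a b F" and "negligible N"
    and deriv: "\<And>x. x \<in> {a..b} - N \<Longrightarrow> (F has_real_derivative h x) (at x within {a..b})"
  shows "(h has_integral F b - F a) {a..b}"
proof -
  \<comment> \<open>The values of \<open>h\<close> on \<open>N\<close> are arbitrary; setting them to 0 leaves only the increments of
    \<open>F\<close> in the part of the Riemann sum that is tagged in \<open>N\<close>.\<close>
  define h0 where "h0 = (\<lambda>x. if x \<in> N then 0 else h x)"
  have "(h0 has_integral F b - F a) {a..b}"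
    unfolding has_integral_real
  proof (intro allI impI)
    fix e :: real assume "e > 0"
    then have "e / 2 > 0" by simp
    then obtain \<delta> where "\<delta> > 0" and \<delta>:
      "\<And>P l r. \<lbrakk>finite (P :: (real \<times> real set) set);
         \<And>i. i \<in> P \<Longrightarrow> a \<le> l i \<and> l i \<le> r i \<and> r i \<le> b;
         disjoint_family_on (\<lambda>i. {l i<..<r i}) P; (\<Sum>i\<in>P. r i - l i) < \<delta>\<rbrakk>
         \<Longrightarrow> (\<Sum>i\<in>P. \<bar>F (r i) - F (l i)\<bar>) < e / 2"
      using abs_continuous_onE_finite[OF ac] by blast
    obtain U where U: "open U" "N \<subseteq> U" "U \<in> lmeasurable" "measure lebesgue U < \<delta>"
    proof -
      obtain T where T: "open T" "N \<subseteq> T" "T - N \<in> lmeasurable" "emeasure lebesgue (T - N) < ennreal \<delta>"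
        using sets_lebesgue_outer_open[OF _ \<open>\<delta> > 0\<close>, of N] negligible_imp_sets[OF \<open>negligible N\<close>] by metis
      have "T = (T - N) \<union> N" using T(2) by blast
      then have "T \<in> lmeasurable"
        using T(3) negligible_imp_measurable[OF \<open>negligible N\<close>] fmeasurable.Un by metis
      moreover have "measure lebesgue T = measure lebesgue (T - N)"
        using T(2,3) \<open>negligible N\<close>
        by (intro measure_negligible_symdiff) (auto elim!: negligible_subset dest: fmeasurableD)
      moreover have "measure lebesgue (T - N) < \<delta>"
        using T(3,4) \<open>\<delta> > 0\<close> by (simp add: emeasure_eq_measure2 ennreal_less_iff)
      ultimately show thesis using T that by auto
    qed
    \<comment> \<open>The summand 1 in the denominator keeps it positive when \<open>a = b\<close>.\<close>
    define \<eta> where "\<eta> = e / (2 * (b - a + 1))"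
    have "\<eta> > 0" and \<eta>: "\<eta> * (b - a) < e / 2"
      using \<open>e > 0\<close> \<open>a \<le> b\<close> by (auto simp: \<eta>_def field_simps)
    have "\<forall>x. \<exists>d>0. (x \<in> N \<longrightarrow> ball x d \<subseteq> U) \<and>
        (x \<in> {a..b} - N \<longrightarrow> (\<forall>u v. u \<in> {a..b} \<and> v \<in> {a..b} \<and> u \<le> x \<and> x \<le> v \<and>
            u \<in> ball x d \<and> v \<in> ball x d \<longrightarrow> \<bar>(F v - F u) - h x * (v - u)\<bar> \<le> \<eta> * (v - u)))"
    proof
      fix x
      consider "x \<in> N" | "x \<in> {a..b} - N" | "x \<notin> N" "x \<notin> {a..b} - N" by blast
      then show "\<exists>d>0. (x \<in> N \<longrightarrow> ball x d \<subseteq> U) \<and>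
        (x \<in> {a..b} - N \<longrightarrow> (\<forall>u v. u \<in> {a..b} \<and> v \<in> {a..b} \<and> u \<le> x \<and> x \<le> v \<and>
            u \<in> ball x d \<and> v \<in> ball x d \<longrightarrow> \<bar>(F v - F u) - h x * (v - u)\<bar> \<le> \<eta> * (v - u)))"
      proof cases
        case 1
        then show ?thesis using U openE by (metis DiffD2 subsetD)
      next
        case 2
        then show ?thesis using straddle[OF deriv[OF 2] \<open>\<eta> > 0\<close>] by (metis DiffD2)
      next
        case 3
        then show ?thesis using zero_less_one by blast
      qed
    qed
    then obtain d where d_pos: "\<And>x. d x > 0" and d_N: "\<And>x. x \<in> N \<Longrightarrow> ball x (d x) \<subseteq> U"
      and d: "\<And>x u v. \<lbrakk>x \<in> {a..b} - N; u \<in> {a..b}; v \<in> {a..b}; u \<le> x; x \<le> v;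
         u \<in> ball x (d x); v \<in> ball x (d x)\<rbrakk> \<Longrightarrow> \<bar>(F v - F u) - h x * (v - u)\<bar> \<le> \<eta> * (v - u)"
      by metis
    show "\<exists>\<gamma>. gauge \<gamma> \<and> (\<forall>\<D>. \<D> tagged_division_of {a..b} \<and> \<gamma> fine \<D> \<longrightarrow>
        norm ((\<Sum>(x, k)\<in>\<D>. measure lborel k *\<^sub>R h0 x) - (F b - F a)) < e)"
    proof (intro exI[of _ "\<lambda>x. ball x (d x)"] conjI allI impI)
      show "gauge (\<lambda>x. ball x (d x))" using d_pos gauge_ball_dependent by blast
    next
      fix p assume "p tagged_division_of {a..b} \<and> (\<lambda>x. ball x (d x)) fine p"
      then have p: "p tagged_division_of {a..b}" and fine: "(\<lambda>x. ball x (d x)) fine p" by auto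
      define l r where "l = (\<lambda>i :: real \<times> real set. Inf (snd i))"
        and "r = (\<lambda>i :: real \<times> real set. Sup (snd i))"
      have fin: "finite p" using p by blast
      have K: "K = {Inf K..Sup K}" "a \<le> Inf K" "Inf K \<le> x" "x \<le> Sup K" "Sup K \<le> b"
        "K \<subseteq> ball x (d x)" if "(x, K) \<in> p" for x K
      proof -
        have "\<exists>u v. K = {u..v}" using tagged_division_ofD(4)[OF p that] by auto
        then obtain u v where uv: "K = {u..v}" by blast
        have "x \<in> K" "K \<subseteq> {a..b}" using tagged_division_ofD(2,3)[OF p that] by auto
        with uv show "K = {Inf K..Sup K}" "a \<le> Inf K" "Inf K \<le> x" "x \<le> Sup K" "Sup K \<le> b"
          by auto
        show "K \<subseteq> ball x (d x)" using fine that by blast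
      qed
      have content: "measure lborel K = Sup K - Inf K" if "(x, K) \<in> p" for x K
        using K(1,3,4)[OF that] by (metis content_real order_trans)
      define P where "P = {i \<in> p. fst i \<in> N}"
      define E where "E = (\<lambda>i. (r i - l i) * h0 (fst i) - (F (r i) - F (l i)))"
      have "(\<Sum>(x, k)\<in>p. measure lborel k *\<^sub>R h0 x) - (F b - F a) = (\<Sum>i\<in>p. E i)"
      proof -
        have "F b - F a = (\<Sum>i\<in>p. F (r i) - F (l i))"
          using additive_tagged_division_1[OF \<open>a \<le> b\<close> p, of F]
          by (simp add: l_def r_def case_prod_unfold)
        moreover have "(\<Sum>(x, k)\<in>p. measure lborel k *\<^sub>R h0 x) = (\<Sum>i\<in>p. (r i - l i) * h0 (fst i))"
          by (intro sum.cong) (auto simp: l_def r_def content)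
        ultimately show ?thesis by (simp add: E_def sum_subtractf)
      qed
      also have "\<bar>\<Sum>i\<in>p. E i\<bar> \<le> (\<Sum>i\<in>p. \<bar>E i\<bar>)" by (rule sum_abs)
      also have "\<dots> = (\<Sum>i\<in>P. \<bar>E i\<bar>) + (\<Sum>i\<in>p - P. \<bar>E i\<bar>)"
        using fin by (subst sum.subset_diff[of P p]) (auto simp: P_def)
      also have "\<dots> < e / 2 + e / 2"
      proof (rule add_strict_mono)
        have "disjoint_family_on (\<lambda>i. {l i<..<r i}) P"
          unfolding disjoint_family_on_def
        proof (intro ballI impI)
          fix i j assume "i \<in> P" "j \<in> P" "i \<noteq> j"
          then have "interior (snd i) \<inter> interior (snd j) = {}"
            using tagged_division_ofD(5)[OF p, of "fst i" "snd i" "fst j" "snd j"]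
            by (auto simp: P_def)
          moreover have "interior (snd i) = {l i<..<r i}" if "i \<in> P" for i
            using K(1)[of "fst i" "snd i"] that
            by (simp add: P_def l_def r_def) (metis interior_atLeastAtMost_real)
          ultimately show "{l i<..<r i} \<inter> {l j<..<r j} = {}"
            using \<open>i \<in> P\<close> \<open>j \<in> P\<close> by auto
        qed
        moreover have "a \<le> l i \<and> l i \<le> r i \<and> r i \<le> b" if "i \<in> P" for i
          using K(2-5)[of "fst i" "snd i"] that by (auto simp: P_def l_def r_def)
        moreover have "{l i<..<r i} \<subseteq> U" if "i \<in> P" for i
        proof -
          have "{l i<..<r i} \<subseteq> {l i..r i}" by auto
          also have "\<dots> \<subseteq> U"
            using K(1,6)[of "fst i" "snd i"] d_N[of "fst i"] that
            by (auto simp: P_def l_def r_def)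
          finally show ?thesis .
        qed
        moreover have "finite P" using fin by (simp add: P_def)
        ultimately have "(\<Sum>i\<in>P. \<bar>F (r i) - F (l i)\<bar>) < e / 2"
          using U(3,4) sum_length_le_measure[of P l r U] by (intro \<delta>) (auto intro: le_less_trans)
        moreover have "\<bar>E i\<bar> = \<bar>F (r i) - F (l i)\<bar>" if "i \<in> P" for i
          using that by (simp add: E_def P_def h0_def)
        ultimately show "(\<Sum>i\<in>P. \<bar>E i\<bar>) < e / 2" by simp
      next
        have "\<bar>E i\<bar> \<le> \<eta> * (r i - l i)" if i: "i \<in> p - P" for i
        proof -
          obtain x K where [simp]: "i = (x, K)" by fastforce
          have xK: "(x, K) \<in> p" "x \<notin> N" using i by (auto simp: P_def)
          note K = K[OF xK(1)]
          have "Inf K \<in> K" "Sup K \<in> K" using K(1,3,4) by (metis atLeastAtMost_iff order_trans order_refl)+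
          then have "\<bar>(F (Sup K) - F (Inf K)) - h x * (Sup K - Inf K)\<bar> \<le> \<eta> * (Sup K - Inf K)"
            using K xK by (intro d) auto
          then show ?thesis
            using xK(2) by (simp add: E_def h0_def l_def r_def abs_minus_commute mult.commute)
        qed
        then have "(\<Sum>i\<in>p - P. \<bar>E i\<bar>) \<le> (\<Sum>i\<in>p - P. \<eta> * (r i - l i))"
          by (rule sum_mono)
        also have "\<dots> \<le> (\<Sum>i\<in>p. \<eta> * (r i - l i))"
        proof (rule sum_mono2)
          fix i assume "i \<in> p - (p - P)"
          then show "0 \<le> \<eta> * (r i - l i)"
            using K(3,4)[of "fst i" "snd i"] \<open>\<eta> > 0\<close> by (auto simp: l_def r_def)
        qed (use fin in auto)
        also have "\<dots> = \<eta> * (b - a)"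
          using additive_tagged_division_1[OF \<open>a \<le> b\<close> p, of "\<lambda>x. x"]
          by (simp add: l_def r_def case_prod_unfold flip: sum_distrib_left)
        finally show "(\<Sum>i\<in>p - P. \<bar>E i\<bar>) < e / 2" using \<eta> by simp
      qed
      finally show "norm ((\<Sum>(x, k)\<in>p. measure lborel k *\<^sub>R h0 x) - (F b - F a)) < e" by simp
    qed
  qed
  then show ?thesis
    by (rule has_integral_spike[OF \<open>negligible N\<close>, rotated]) (auto simp: h0_def)
qed

text \<open>
  If the almost-everywhere derivative has a continuous representative, then the function is the
  indefinite integral of that representative and hence differentiable at every point.
\<close>

lemma abs_continuous_on_deriv_everywhere:
  fixes F h :: "real \<Rightarrow> real"
  assumes ac: "abs_continuous_on a b F"
    and ae: "AE x in lebesgue_on {a..b}. (F has_real_derivative h x) (at x within {a..b})"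
    and cont: "continuous_on {a..b} h" and "x \<in> {a..b}"
  shows "(F has_real_derivative h x) (at x within {a..b})"
proof -
  define N where "N = {y \<in> {a..b}. \<not> (F has_real_derivative h y) (at y within {a..b})}"
  have "AE y in lebesgue. y \<in> {a..b} \<longrightarrow> (F has_real_derivative h y) (at y within {a..b})"
    using ae by (simp add: AE_restrict_space_iff)
  then have N: "negligible N"
    unfolding N_def negligible_iff_null_sets
    by (simp add: completion.AE_iff_null_sets Collect_conj_eq[symmetric] not_imp)
  have F_eq: "F y = F a + integral {a..y} h" if y: "y \<in> {a..b}" for y
  proof -
    have "(h has_integral F y - F a) {a..y}"
    proof (rule abs_continuous_on_has_integral[OF _ _ N])
      show "abs_continuous_on a y F" using abs_continuous_on_subinterval[OF ac] y by auto
      show "(F has_real_derivative h z) (at z within {a..y})" if "z \<in> {a..y} - N" for z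
        using that y by (auto simp: N_def intro: DERIV_subset[of F _ z "{a..b}"])
    qed (use y in auto)
    then show ?thesis by (simp add: integral_unique)
  qed
  have "((\<lambda>y. F a + integral {a..y} h) has_real_derivative h x) (at x within {a..b})"
    using integral_has_real_derivative[OF cont \<open>x \<in> {a..b}\<close>] by (auto intro!: derivative_eq_intros)
  then show ?thesis
  proof (rule has_field_derivative_transform_within[where d = 1])
    show "F a + integral {a..y} h = F y" if "y \<in> {a..b}" for y
      using F_eq[OF that] by (rule sym)
  qed (use \<open>x \<in> {a..b}\<close> in auto)
qed

section \<open>Solving the Neumann eigenvalue problem\<close>

text \<open>
  An eigenfunction is continuous, and so is \<open>\<mu> * f\<close>; the eigenvalue equation, imposed only
  almost everywhere, therefore holds everywhere.
\<close>

lemma neumann_eigenfunction_classical: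
  assumes "neumann_eigenfunction \<mu> f"
  obtains f' where
    "\<And>x. x \<in> {-1..1} \<Longrightarrow> (f has_real_derivative f' x) (at x within {-1..1})"
    "\<And>x. x \<in> {-1..1} \<Longrightarrow> (f' has_real_derivative \<mu> * f x) (at x within {-1..1})"
    "f' (-1) = 0" "f' 1 = 0"
proof -
  obtain f' where f': "\<And>x. x \<in> {-1..1} \<Longrightarrow> (f has_real_derivative f' x) (at x within {-1..1})"
    and ac: "abs_continuous_on (-1) 1 f'" and bc: "f' (-1) = 0" "f' 1 = 0"
    and ae: "AE x in lebesgue_on {-1..1}. (f' has_real_derivative \<mu> * f x) (at x within {-1..1})"
    using assms unfolding neumann_eigenfunction_def neumann_laplacian_def by blast
  have "continuous_on {-1..1} (\<lambda>x. \<mu> * f x)"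
    using DERIV_continuous_on[OF f'] by (intro continuous_intros)
  from abs_continuous_on_deriv_everywhere[OF ac ae this] show thesis
    using that f' bc by blast
qed

text \<open>
  The integrand is the derivative of \<open>f * f'\<close>, which vanishes at both endpoints.
\<close>

lemma neumann_energy_identity:
  assumes f: "\<And>x. x \<in> {-1..1} \<Longrightarrow> (f has_real_derivative f' x) (at x within {-1..1})"
    and f': "\<And>x. x \<in> {-1..1} \<Longrightarrow> (f' has_real_derivative \<mu> * f x) (at x within {-1..1})"
    and bc: "f' (-1) = 0" "f' 1 = 0"
  shows "((\<lambda>x. (f' x)\<^sup>2 + \<mu> * (f x)\<^sup>2) has_integral 0) {-1..1}"
proof -
  have "((\<lambda>x. (f' x)\<^sup>2 + \<mu> * (f x)\<^sup>2) has_integral f 1 * f' 1 - f (-1) * f' (-1)) {-1..1}"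
  proof (rule fundamental_theorem_of_calculus)
    fix x :: real assume "x \<in> {-1..1}"
    then have "((\<lambda>x. f x * f' x) has_real_derivative (f' x)\<^sup>2 + \<mu> * (f x)\<^sup>2) (at x within {-1..1})"
      by (auto intro!: derivative_eq_intros f f' simp: power2_eq_square)
    then show "((\<lambda>x. f x * f' x) has_vector_derivative (f' x)\<^sup>2 + \<mu> * (f x)\<^sup>2) (at x within {-1..1})"
      by (simp add: has_real_derivative_iff_has_vector_derivative)
  qed simp
  then show ?thesis by (simp add: bc)
qed

text \<open>
  For \<open>\<mu> \<ge> 0\<close> the integrand of the energy identity is nonnegative and continuous, hence
  identically zero. Both its summands vanish, so \<open>f\<close> is a constant and \<open>\<mu> = 0\<close>.
\<close>

lemma neumann_eigenvalue_nonneg: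
  assumes eig: "neumann_eigenfunction \<mu> f" and "\<mu> \<ge> 0"
  obtains c where "\<mu> = 0" "c \<noteq> 0" "\<And>x. x \<in> {-1..1} \<Longrightarrow> f x = c"
proof -
  obtain f' where f: "\<And>x. x \<in> {-1..1} \<Longrightarrow> (f has_real_derivative f' x) (at x within {-1..1})"
    and f': "\<And>x. x \<in> {-1..1} \<Longrightarrow> (f' has_real_derivative \<mu> * f x) (at x within {-1..1})"
    and bc: "f' (-1) = 0" "f' 1 = 0"
    using neumann_eigenfunction_classical[OF eig] by blast
  have "continuous_on {-1..1} (\<lambda>x. (f' x)\<^sup>2 + \<mu> * (f x)\<^sup>2)"
    using DERIV_continuous_on[OF f] DERIV_continuous_on[OF f'] by (intro continuous_intros)
  then have zero: "(f' x)\<^sup>2 + \<mu> * (f x)\<^sup>2 = 0" if "x \<in> {-1..1}" for x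
    using has_integral_0_cbox_imp_0[of "-1" 1 "\<lambda>x. (f' x)\<^sup>2 + \<mu> * (f x)\<^sup>2" x]
      neumann_energy_identity[OF f f' bc] that \<open>\<mu> \<ge> 0\<close> by auto
  have f'_zero: "f' x = 0" and "\<mu> * (f x)\<^sup>2 = 0" if "x \<in> {-1..1}" for x
    using zero[OF that] \<open>\<mu> \<ge> 0\<close> by (simp_all add: add_nonneg_eq_0_iff)
  moreover obtain x0 where x0: "x0 \<in> {-1..1}" "f x0 \<noteq> 0"
    using eig unfolding neumann_eigenfunction_def by blast
  ultimately have "\<mu> = 0" by fastforce
  obtain c where c: "\<And>x. x \<in> {-1..1} \<Longrightarrow> f x = c"
    using has_field_derivative_zero_constant[of "{-1..1}" f] f f'_zero by fastforce
  with \<open>\<mu> = 0\<close> x0 that show thesis by auto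
qed

text \<open>
  Uniqueness for the initial value problem by two first integrals: in phase space the solution
  rotates uniformly, so the coordinates \<open>P\<close> and \<open>Q\<close> of \<open>(k * f, f')\<close> in the
  co-rotating frame are constant.
\<close>

lemma harmonic_oscillator_cos:
  fixes f f' :: "real \<Rightarrow> real"
  assumes f: "\<And>x. x \<in> {a..b} \<Longrightarrow> (f has_real_derivative f' x) (at x within {a..b})"
    and f': "\<And>x. x \<in> {a..b} \<Longrightarrow> (f' has_real_derivative - k\<^sup>2 * f x) (at x within {a..b})"
    and "f' a = 0" "k \<noteq> 0" and x: "x \<in> {a..b}"
  shows "f x = f a * cos (k * (x - a))" "f' x = - k * f a * sin (k * (x - a))"
proof -
  define C S where "C = (\<lambda>x. cos (k * (x - a)))" and "S = (\<lambda>x. sin (k * (x - a)))"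
  define P Q where "P = (\<lambda>x. k * f x * C x - f' x * S x)" and "Q = (\<lambda>x. k * f x * S x + f' x * C x)"
  have "(P has_real_derivative 0) (at y within {a..b})" "(Q has_real_derivative 0) (at y within {a..b})"
    if "y \<in> {a..b}" for y
    unfolding P_def Q_def C_def S_def using that
    by (auto intro!: derivative_eq_intros f f' simp: algebra_simps power2_eq_square)
  then obtain p q where "\<And>y. y \<in> {a..b} \<Longrightarrow> P y = p" "\<And>y. y \<in> {a..b} \<Longrightarrow> Q y = q"
    using has_field_derivative_zero_constant[of "{a..b}" P]
      has_field_derivative_zero_constant[of "{a..b}" Q] by (metis convex_real_interval(5))
  then have "P x = P a" "Q x = Q a" using x by auto
  then have PQ: "P x = k * f a" "Q x = 0"
    using \<open>f' a = 0\<close> by (simp_all add: P_def Q_def C_def S_def)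
  have one: "(C x)\<^sup>2 + (S x)\<^sup>2 = 1" by (simp add: C_def S_def)
  have "k * f x = k * f x * ((C x)\<^sup>2 + (S x)\<^sup>2)" by (simp only: one)
  also have "\<dots> = P x * C x + Q x * S x"
    by (simp add: P_def Q_def algebra_simps power2_eq_square)
  finally show "f x = f a * cos (k * (x - a))"
    using PQ \<open>k \<noteq> 0\<close> by (simp add: C_def)
  have "f' x = f' x * ((C x)\<^sup>2 + (S x)\<^sup>2)" by (simp only: one)
  also have "\<dots> = Q x * C x - P x * S x"
    by (simp add: P_def Q_def algebra_simps power2_eq_square)
  finally show "f' x = - k * f a * sin (k * (x - a))"
    using PQ by (simp add: S_def)
qed

text \<open>
  The condition on \<open>k\<close> is the Neumann condition at the right endpoint; the one at the left
  endpoint holds for every \<open>k\<close>.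
\<close>

lemma neumann_eigenfunction_cos:
  assumes f: "\<And>x. x \<in> {-1..1} \<Longrightarrow> f x = c * cos (k * (x + 1))"
    and "c \<noteq> 0" "sin (2 * k) = 0"
  shows "neumann_eigenfunction (- k\<^sup>2) f"
proof -
  define f' where "f' = (\<lambda>x. - c * k * sin (k * (x + 1)))"
  have df: "(f has_real_derivative f' x) (at x within {-1..1})" if "x \<in> {-1..1}" for x
  proof (rule has_field_derivative_transform_within[OF _ zero_less_one that])
    show "((\<lambda>x. c * cos (k * (x + 1))) has_real_derivative f' x) (at x within {-1..1})"
      unfolding f'_def by (auto intro!: derivative_eq_intros)
  qed (simp add: f)
  have df': "(f' has_real_derivative - k\<^sup>2 * f x) (at x within {-1..1})" if "x \<in> {-1..1}" for x
    unfolding f'_def f[OF that] by (auto intro!: derivative_eq_intros simp: power2_eq_square)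
  have cont: "continuous_on {-1..1} f'" "continuous_on {-1..1} (\<lambda>x. - k\<^sup>2 * f x)"
    by (intro continuous_intros DERIV_continuous_on[OF df] DERIV_continuous_on[OF df']; assumption)+
  have "neumann_laplacian f (\<lambda>x. - k\<^sup>2 * f x)"
    unfolding neumann_laplacian_def
  proof (intro conjI exI[of _ f'] ballI)
    show "abs_continuous_on (-1) 1 f"
      using df cont(1) by (rule continuously_differentiable_imp_abs_continuous_on)
    show "abs_continuous_on (-1) 1 f'"
      using df' cont(2) by (rule continuously_differentiable_imp_abs_continuous_on)
    show "f' (-1) = 0" "f' 1 = 0" using assms(3) by (auto simp: f'_def mult.commute)
    show "AE x in lebesgue_on {-1..1}. (f' has_real_derivative - k\<^sup>2 * f x) (at x within {-1..1})"
      by (rule AE_I2) (use df' in simp)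
  qed (use df in auto)
  moreover have "f (-1) \<noteq> 0" using f[of "-1"] \<open>c \<noteq> 0\<close> by simp
  ultimately show ?thesis
    unfolding neumann_eigenfunction_def by fastforce
qed

section \<open>The spectrum and its enumeration\<close>

text \<open>
  Measuring the angle from the left endpoint merges the two parities: all eigenfunctions are cosines
  of $k(x+1)$, and the shift by $j\pi/2$ only costs a sign. This form connects the definition of
  the eigenfunctions with the solution of the initial value problem at $-1$.
\<close>

lemma neumann_phi_eq_cos:
  "neumann_phi j x = (-1) ^ ((j + 1) div 2) * cos (real j * pi / 2 * (x + 1))"
proof (cases "even j")
  case True
  then obtain m where [simp]: "j = 2 * m" by blast
  have "cos (real j * pi / 2 * (x + 1)) = cos (real m * pi * x + real m * pi)"
    by (simp add: algebra_simps)
  also have "\<dots> = (-1) ^ m * cos (real m * pi * x)"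
    by (simp add: cos_add)
  finally show ?thesis by (simp add: neumann_phi_def mult.assoc flip: power_mult_distrib power_add mult_2)
next
  case False
  then obtain m where [simp]: "j = 2 * m + 1" by (rule oddE)
  have "cos (real j * pi / 2 * (x + 1)) = cos ((real j * pi * x / 2 + real m * pi) + pi / 2)"
    by (simp add: algebra_simps add_divide_distrib)
  also have "\<dots> = - ((-1) ^ m * sin (real j * pi * x / 2))"
    by (simp only: cos_add sin_add) simp
  finally show ?thesis
    using False by (simp add: neumann_phi_def flip: power_mult_distrib power_add mult_2)
qed

lemma neumann_phi_eigenfunction:
  assumes "c \<noteq> 0" "\<And>x. x \<in> {-1..1} \<Longrightarrow> f x = c * neumann_phi j x"
  shows "neumann_eigenfunction (- (real j * pi / 2)\<^sup>2) f"
  by (rule neumann_eigenfunction_cos[of _ "c * (-1) ^ ((j + 1) div 2)"])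
     (use assms in \<open>auto simp: neumann_phi_eq_cos sin_npi\<close>)

text \<open>
  For \<open>\<mu> = - k\<^sup>2\<close> the Neumann condition at $-1$ leaves only multiples of $\cos(k(x+1))$, and
  the one at $1$ forces $\sin(2k) = 0$, that is, $k = j\pi/2$.
\<close>

lemma neumann_eigenfunction_classification:
  assumes eig: "neumann_eigenfunction \<mu> f"
  obtains j c where "\<mu> = - (real j * pi / 2)\<^sup>2" "c \<noteq> 0"
    "\<And>x. x \<in> {-1..1} \<Longrightarrow> f x = c * neumann_phi j x"
proof (cases "\<mu> \<ge> 0")
  case True
  obtain c where "\<mu> = 0" "c \<noteq> 0" "\<And>x. x \<in> {-1..1} \<Longrightarrow> f x = c"
    using neumann_eigenvalue_nonneg[OF eig True] by blast
  then show thesis using that[of 0 c] by (simp add: neumann_phi_def)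
next
  case False
  define k where "k = sqrt (- \<mu>)"
  have k: "k > 0" "\<mu> = - k\<^sup>2" using False by (simp_all add: k_def)
  obtain f' where f: "\<And>x. x \<in> {-1..1} \<Longrightarrow> (f has_real_derivative f' x) (at x within {-1..1})"
    and f': "\<And>x. x \<in> {-1..1} \<Longrightarrow> (f' has_real_derivative - k\<^sup>2 * f x) (at x within {-1..1})"
    and bc: "f' (-1) = 0" "f' 1 = 0"
    using neumann_eigenfunction_classical[OF eig] k(2) by metis
  have sol: "f x = f (-1) * cos (k * (x + 1))" "f' x = - k * f (-1) * sin (k * (x + 1))"
    if "x \<in> {-1..1}" for x
    using harmonic_oscillator_cos[OF f f' bc(1) _ that] k(1) by auto
  have "f (-1) \<noteq> 0"
    using eig sol(1) unfolding neumann_eigenfunction_def by force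
  then have "sin (2 * k) = 0"
    using sol(2)[of 1] bc(2) k(1) by (simp add: mult.commute)
  then obtain i :: int where i: "2 * k = of_int i * pi"
    using sin_zero_iff_int2 by blast
  then have "i > 0" using k(1) by (metis mult_pos_pos of_int_0_less_iff pi_gt_zero zero_less_mult_pos2 zero_less_numeral)
  define j where "j = nat i"
  have kj: "k = real j * pi / 2" using i \<open>i > 0\<close> by (simp add: j_def)
  show thesis
  proof (rule that[of j "(-1) ^ ((j + 1) div 2) * f (-1)"])
    show "f x = (-1) ^ ((j + 1) div 2) * f (-1) * neumann_phi j x" if "x \<in> {-1..1}" for x
      using sol(1)[OF that] by (simp add: neumann_phi_eq_cos kj)
  qed (use k(2) kj \<open>f (-1) \<noteq> 0\<close> in auto)
qed

lemma neumann_eigenvalue_iff: "neumann_eigenvalue \<mu> \<longleftrightarrow> (\<exists>j. \<mu> = - (real j * pi / 2)\<^sup>2)"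
  unfolding neumann_eigenvalue_def
  by (metis neumann_eigenfunction_classification neumann_phi_eigenfunction mult_1 zero_neq_one)

lemma neumann_eigenvalue_less_iff:
  "- (real i * pi / 2)\<^sup>2 < - (real j * pi / 2)\<^sup>2 \<longleftrightarrow> j < i"
proof -
  have "(real i)\<^sup>2 \<le> (real j)\<^sup>2 \<longleftrightarrow> i \<le> j" by simp
  then show ?thesis
    by (simp add: power_mult_distrib power_divide divide_less_cancel del: power_mono_iff) linarith
qed

lemma neumann_eigenvalue_eq_iff:
  "- (real i * pi / 2)\<^sup>2 = - (real j * pi / 2)\<^sup>2 \<longleftrightarrow> i = j"
  by (metis neumann_eigenvalue_less_iff less_irrefl linorder_neqE_nat)

lemma neumann_eigenvalues_above:
  "{\<nu>. neumann_eigenvalue \<nu> \<and> \<nu> > - (real j * pi / 2)\<^sup>2} = (\<lambda>i. - (real i * pi / 2)\<^sup>2) ` {..<j}"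
  by (auto simp: neumann_eigenvalue_iff neumann_eigenvalue_less_iff simp del: neg_less_iff_less)

lemma finite_card_neumann_eigenvalues_above:
  "finite {\<nu>. neumann_eigenvalue \<nu> \<and> \<nu> > - (real j * pi / 2)\<^sup>2}"
  "card {\<nu>. neumann_eigenvalue \<nu> \<and> \<nu> > - (real j * pi / 2)\<^sup>2} = j"
proof -
  have "inj_on (\<lambda>i. - (real i * pi / 2)\<^sup>2) {..<j}"
    by (rule inj_onI) (simp only: neumann_eigenvalue_eq_iff)
  then show "finite {\<nu>. neumann_eigenvalue \<nu> \<and> \<nu> > - (real j * pi / 2)\<^sup>2}"
    "card {\<nu>. neumann_eigenvalue \<nu> \<and> \<nu> > - (real j * pi / 2)\<^sup>2} = j"
    by (simp_all only: neumann_eigenvalues_above card_image) auto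
qed

text \<open>
  The number of eigenvalues above a given one recovers its index, so counting identifies \<open>\<mu>\<close>,
  and the classification shows that its eigenspace is one-dimensional.
\<close>

lemma is_jth_neumann_eigenfunction_iff:
  "is_jth_neumann_eigenfunction j f \<longleftrightarrow> (\<exists>c. c \<noteq> 0 \<and> (\<forall>x\<in>{-1..1}. f x = c * neumann_phi j x))"
proof
  assume "is_jth_neumann_eigenfunction j f"
  then obtain \<mu> where eig: "neumann_eigenfunction \<mu> f"
    and card: "card {\<nu>. neumann_eigenvalue \<nu> \<and> \<nu> > \<mu>} = j"
    unfolding is_jth_neumann_eigenfunction_def by blast
  obtain i c where i: "\<mu> = - (real i * pi / 2)\<^sup>2" "c \<noteq> 0"
    "\<And>x. x \<in> {-1..1} \<Longrightarrow> f x = c * neumann_phi i x"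
    using neumann_eigenfunction_classification[OF eig] by blast
  have "i = j" using card finite_card_neumann_eigenvalues_above(2)[of i] i(1) by simp
  with i show "\<exists>c. c \<noteq> 0 \<and> (\<forall>x\<in>{-1..1}. f x = c * neumann_phi j x)" by blast
next
  assume "\<exists>c. c \<noteq> 0 \<and> (\<forall>x\<in>{-1..1}. f x = c * neumann_phi j x)"
  then show "is_jth_neumann_eigenfunction j f"
    unfolding is_jth_neumann_eigenfunction_def
    using neumann_phi_eigenfunction finite_card_neumann_eigenvalues_above by blast
qed

lemma is_first_nonconstant_neumann_phi_1:
  "is_first_nonconstant_neumann_eigenfunction (neumann_phi 1)"
  unfolding is_first_nonconstant_neumann_eigenfunction_def
proof (intro exI[of _ "- (real 1 * pi / 2)\<^sup>2"] conjI allI impI)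
  show "neumann_eigenfunction (- (real 1 * pi / 2)\<^sup>2) (neumann_phi 1)"
    by (rule neumann_phi_eigenfunction[of 1]) auto
  have "neumann_phi 1 0 \<noteq> neumann_phi 1 1" by (simp add: neumann_phi_def)
  then show "\<not> neumann_phi 1 constant_on {-1..1}"
    unfolding constant_on_def by (metis atLeastAtMost_iff le_numeral_extra(1) neg_le_0_iff_le order_refl zero_le_one order_trans)
next
  fix \<nu> g assume g: "neumann_eigenfunction \<nu> g \<and> \<not> g constant_on {-1..1}"
  then obtain j c where j: "\<nu> = - (real j * pi / 2)\<^sup>2"
    "\<And>x. x \<in> {-1..1} \<Longrightarrow> g x = c * neumann_phi j x"
    using neumann_eigenfunction_classification by metis
  have "j \<noteq> 0"
  proof
    assume "j = 0"
    then have "g constant_on {-1..1}"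
      using j(2) by (auto simp: constant_on_def neumann_phi_def)
    with g show False by blast
  qed
  then show "\<nu> \<le> - (real 1 * pi / 2)\<^sup>2"
    using neumann_eigenvalue_less_iff[of 1 j] j(1) by linarith
qed

section \<open>Chebyshev polynomials\<close>

text \<open>
  Since $\phi_1(x) = \sin(\pi x/2) = \cos(\pi(1-x)/2)$, the polynomial $T_j$ turns it into
  $\cos(j\pi(1-x)/2)$, which up to sign is $\phi_j(-x)$; the parity of $\phi_j$ removes the
  reflection.
\<close>

lemma neumann_phi_chebyshev:
  "neumann_phi j x =
     (if even j then (-1) ^ (j div 2) * poly (chebyshev_T j) (neumann_phi 1 x)
      else (-1) ^ ((j - 1) div 2) * poly (chebyshev_T j) (neumann_phi 1 x))"
proof -
  define \<theta> where "\<theta> = pi / 2 * (- x + 1)"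
  have "neumann_phi 1 x = cos \<theta>"
    by (simp add: neumann_phi_def \<theta>_def sin_cos_eq field_simps)
  then have T: "poly (chebyshev_T j) (neumann_phi 1 x) = cos (real j * pi / 2 * (- x + 1))"
    by (simp add: poly_chebyshev_T_cos \<theta>_def mult.assoc)
  have "(-1) ^ ((j + 1) div 2) * neumann_phi j (- x) = cos (real j * pi / 2 * (- x + 1))"
    by (simp add: neumann_phi_eq_cos flip: mult.assoc power_mult_distrib)
  moreover have "neumann_phi j (- x) = (if even j then 1 else -1) * neumann_phi j x"
    by (simp add: neumann_phi_def)
  ultimately have "poly (chebyshev_T j) (neumann_phi 1 x) =
      (-1) ^ ((j + 1) div 2) * ((if even j then 1 else -1) * neumann_phi j x)"
    using T by simp
  then show ?thesis
    by (auto elim!: evenE oddE simp flip: mult.assoc power_mult_distrib)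
qed

theorem proposition4p9:
  shows "(\<forall>j. neumann_eigenfunction (- (real j * pi / 2)\<^sup>2) (neumann_phi j))
       \<and> (\<forall>j f. is_jth_neumann_eigenfunction j f
              \<longleftrightarrow> (\<exists>c. c \<noteq> 0 \<and> (\<forall>x\<in>{-1..1}. f x = c * neumann_phi j x)))
       \<and> is_first_nonconstant_neumann_eigenfunction (neumann_phi 1)
       \<and> (\<forall>j. \<forall>x\<in>{-1..1}. neumann_phi j x =
            (if even j then (-1) ^ (j div 2) * poly (chebyshev_T j) (neumann_phi 1 x)
             else (-1) ^ ((j - 1) div 2) * poly (chebyshev_T j) (neumann_phi 1 x)))"
proof (intro conjI allI ballI)
  show "neumann_eigenfunction (- (real j * pi / 2)\<^sup>2) (neumann_phi j)" for j
    by (rule neumann_phi_eigenfunction[of 1]) auto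
qed (rule is_jth_neumann_eigenfunction_iff is_first_nonconstant_neumann_phi_1 neumann_phi_chebyshev)+

end
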